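(* Let $k\ge 1$ be an integer and let $H$ be a finite chordal graph with clique number $\omega(H) = k+1$. Then $\chi_{\mathrm{g}}^{(k)}(H) \le k+3$.
   Context: The $k$-clique-relaxed $n$-coloring game on a finite graph $G$: there is a fixed set of $n$ colors; Alice moves first, and Alice and Bob alternately choose an uncolored vertex and assign it one of the $n$ colors, subject to the rule that at no point in the game may there be a monochromatic clique on $k+1$ vertices (a color is legal for a vertex if assigning it creates no monochromatic $(k+1)$-clique). Alice wins if the game ends with all vertices colored; Bob wins if at some point an uncolored vertex has no legal color. The $k$-clique-relaxed game chromatic number $\chi_{\mathrm{g}}^{(k)}(G)$ is the least $n$ such that Alice has a winning strategy in this game. A graph is chordal if it has no induced cycle of length at least 4; $\omega(H)$ denotes the clique number. *)

theory Defs
  imports "HOL-Library.Ramsey"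
begin

text \<open>
  A finite simple graph is a pair \<open>V\<close>, \<open>E\<close> with edges that are 2-element subsets of \<open>V\<close>.
  Cliques are those of \<^theory>\<open>HOL-Library.Ramsey\<close>.
\<close>

definition finite_graph :: "'a set \<Rightarrow> 'a set set \<Rightarrow> bool" where
  "finite_graph V E \<longleftrightarrow> finite V \<and> E \<subseteq> [V]\<^bsup>2\<^esup>"

definition clique_number :: "'a set \<Rightarrow> 'a set set \<Rightarrow> nat" where
  "clique_number V E = Max {card C | C. C \<subseteq> V \<and> clique C E}"

text \<open>
  The list enumerates the vertices of the cycle in cyclic order; the equivalence says that the
  subgraph induced on them has no edges besides those of the cycle.
\<close>

definition induced_cycle :: "'a set \<Rightarrow> 'a set set \<Rightarrow> 'a list \<Rightarrow> bool" where
  "induced_cycle V E xs \<longleftrightarrow>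
     length xs \<ge> 3 \<and> distinct xs \<and> set xs \<subseteq> V \<and>
     (\<forall>i j. i < j \<and> j < length xs \<longrightarrow>
        ({xs ! i, xs ! j} \<in> E \<longleftrightarrow> j = Suc i \<or> (i = 0 \<and> Suc j = length xs)))"

definition chordal :: "'a set \<Rightarrow> 'a set set \<Rightarrow> bool" where
  "chordal V E \<longleftrightarrow> \<not> (\<exists>xs. induced_cycle V E xs \<and> length xs \<ge> 4)"

text \<open>
  The set of colors is \<open>{..<n}\<close>. A move is a pair of a vertex and a color. A play is the list of
  the moves made so far, most recent move first, so that \<^const>\<open>map_of\<close> yields the current partial
  coloring and Alice is to move iff the length is even.
\<close>

type_synonym 'a move = "'a \<times> nat"
type_synonym 'a play = "'a move list"

definition has_mono_clique :: "'a set set \<Rightarrow> nat \<Rightarrow> ('a \<rightharpoonup> nat) \<Rightarrow> bool" where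
  "has_mono_clique E m f \<longleftrightarrow> (\<exists>C c. clique C E \<and> card C = m \<and> (\<forall>v\<in>C. f v = Some c))"

definition uncolored :: "'a set \<Rightarrow> 'a play \<Rightarrow> 'a set" where
  "uncolored V p = V - dom (map_of p)"

definition legal_color :: "'a set set \<Rightarrow> nat \<Rightarrow> nat \<Rightarrow> 'a play \<Rightarrow> 'a \<Rightarrow> nat \<Rightarrow> bool" where
  "legal_color E k n p v c \<longleftrightarrow> c < n \<and> \<not> has_mono_clique E (k + 1) ((map_of p)(v \<mapsto> c))"

definition legal_move :: "'a set \<Rightarrow> 'a set set \<Rightarrow> nat \<Rightarrow> nat \<Rightarrow> 'a play \<Rightarrow> 'a move \<Rightarrow> bool" where
  "legal_move V E k n p m \<longleftrightarrow> fst m \<in> uncolored V p \<and> legal_color E k n p (fst m) (snd m)"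

definition alice_won :: "'a set \<Rightarrow> 'a play \<Rightarrow> bool" where
  "alice_won V p \<longleftrightarrow> uncolored V p = {}"

definition bob_won :: "'a set \<Rightarrow> 'a set set \<Rightarrow> nat \<Rightarrow> nat \<Rightarrow> 'a play \<Rightarrow> bool" where
  "bob_won V E k n p \<longleftrightarrow> (\<exists>v\<in>uncolored V p. \<not> (\<exists>c. legal_color E k n p v c))"

definition game_over :: "'a set \<Rightarrow> 'a set set \<Rightarrow> nat \<Rightarrow> nat \<Rightarrow> 'a play \<Rightarrow> bool" where
  "game_over V E k n p \<longleftrightarrow> alice_won V p \<or> bob_won V E k n p"

text \<open>Plays that can arise when Alice follows \<open>\<sigma>\<close> and Bob moves arbitrarily.\<close>

inductive_set plays_of :: "'a set \<Rightarrow> 'a set set \<Rightarrow> nat \<Rightarrow> nat \<Rightarrow> ('a play \<Rightarrow> 'a move) \<Rightarrow> 'a play set"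
  for V E k n \<sigma> where
  start: "[] \<in> plays_of V E k n \<sigma>"
| alice: "\<lbrakk>p \<in> plays_of V E k n \<sigma>; \<not> game_over V E k n p; even (length p);
           legal_move V E k n p (\<sigma> p)\<rbrakk> \<Longrightarrow> \<sigma> p # p \<in> plays_of V E k n \<sigma>"
| bob: "\<lbrakk>p \<in> plays_of V E k n \<sigma>; \<not> game_over V E k n p; odd (length p);
           legal_move V E k n p m\<rbrakk> \<Longrightarrow> m # p \<in> plays_of V E k n \<sigma>"

text \<open>
  Every move colors a new vertex, so on a finite graph every play ends; a strategy wins if
  it always prescribes a legal move and every play that has ended was won by Alice.
\<close>

definition winning_strategy ::
    "'a set \<Rightarrow> 'a set set \<Rightarrow> nat \<Rightarrow> nat \<Rightarrow> ('a play \<Rightarrow> 'a move) \<Rightarrow> bool" where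
  "winning_strategy V E k n \<sigma> \<longleftrightarrow>
     (\<forall>p \<in> plays_of V E k n \<sigma>.
        (\<not> game_over V E k n p \<and> even (length p) \<longrightarrow> legal_move V E k n p (\<sigma> p)) \<and>
        (game_over V E k n p \<longrightarrow> alice_won V p))"

definition game_chromatic_number :: "nat \<Rightarrow> 'a set \<Rightarrow> 'a set set \<Rightarrow> nat" where
  "game_chromatic_number k V E = (LEAST n. \<exists>\<sigma>. winning_strategy V E k n \<sigma>)"

text \<open>
  For \<open>k \<ge> 1\<close> Alice wins with \<open>card V\<close> colors, so the minimum defining the
  game chromatic number is over a nonempty set.
\<close>

lemma map_of_Cons_upd: "map_of (m # p) = (map_of p)(fst m \<mapsto> snd m)"
  by (auto simp: fun_upd_def)

lemma plays_of_no_mono_clique: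
  "p \<in> plays_of V E k n \<sigma> \<Longrightarrow>
     dom (map_of p) \<subseteq> V \<and> \<not> has_mono_clique E (k + 1) (map_of p)"
proof (induction rule: plays_of.induct)
  case start
  show ?case by (auto simp: has_mono_clique_def)
next
  case (alice p)
  then show ?case
    unfolding map_of_Cons_upd legal_move_def legal_color_def uncolored_def dom_fun_upd
    by (simp del: fun_upd_apply)
next
  case (bob p m)
  then show ?case
    unfolding map_of_Cons_upd legal_move_def legal_color_def uncolored_def dom_fun_upd
    by (simp del: fun_upd_apply)
qed

lemma legal_color_exists:
  assumes "finite V" "k \<ge> 1" "dom (map_of p) \<subseteq> V" "\<not> has_mono_clique E (k + 1) (map_of p)"
    "v \<in> uncolored V p"
  shows "\<exists>c. legal_color E k (card V) p v c"
proof -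
  have "dom (map_of p) \<subset> V"
    using assms(3,5) by (auto simp: uncolored_def)
  then have "card (dom (map_of p)) < card V"
    using assms(1) by (rule psubset_card_mono[rotated])
  moreover have "card (ran (map_of p)) \<le> card (dom (map_of p))"
  proof -
    have "ran (map_of p) = (the \<circ> map_of p) ` dom (map_of p)"
      by (force simp: ran_def)
    then show ?thesis
      using finite_dom_map_of by (metis card_image_le)
  qed
  ultimately have "card (ran (map_of p)) < card {..<card V}"
    by simp
  then have "\<not> {..<card V} \<subseteq> ran (map_of p)"
    using card_mono[OF finite_ran[OF finite_dom_map_of[of p]]] by (meson leD)
  then obtain c where c: "c < card V" "c \<notin> ran (map_of p)"
    by auto
  have "\<not> has_mono_clique E (k + 1) ((map_of p)(v \<mapsto> c))"
  proof
    assume "has_mono_clique E (k + 1) ((map_of p)(v \<mapsto> c))"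
    then obtain C d where C: "clique C E" "card C = k + 1"
      "\<forall>u\<in>C. ((map_of p)(v \<mapsto> c)) u = Some d"
      by (auto simp: has_mono_clique_def)
    have "v \<in> C"
    proof (rule ccontr)
      assume "v \<notin> C"
      with C(3) have "\<forall>u\<in>C. map_of p u = Some d"
        by (metis fun_upd_other)
      with C assms(4) show False
        by (auto simp: has_mono_clique_def)
    qed
    then have "d = c"
      using C(3) by auto
    have "\<not> C \<subseteq> {v}"
    proof
      assume "C \<subseteq> {v}"
      then have "card C \<le> 1"
        using card_mono[of "{v}" C] by simp
      with C(2) assms(2) show False
        by simp
    qed
    then obtain u where "u \<in> C" "u \<noteq> v"
      by auto
    with C(3) \<open>d = c\<close> have "map_of p u = Some c"
      by auto
    with c(2) show False
      by (auto simp: ran_def)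
  qed
  with c show ?thesis
    by (auto simp: legal_color_def)
qed

lemma winning_strategy_exists:
  assumes "finite V" "k \<ge> 1"
  shows "\<exists>n \<sigma>. winning_strategy V E k n \<sigma>"
proof -
  define \<sigma> where "\<sigma> = (\<lambda>p. SOME m. legal_move V E k (card V) p m)"
  have *: "\<exists>c. legal_color E k (card V) p v c"
    if "p \<in> plays_of V E k (card V) \<sigma>" "v \<in> uncolored V p" for p v
    using legal_color_exists[OF assms] plays_of_no_mono_clique[OF that(1)] that(2) by blast
  have "winning_strategy V E k (card V) \<sigma>"
    unfolding winning_strategy_def
  proof (intro ballI conjI impI)
    fix p assume p: "p \<in> plays_of V E k (card V) \<sigma>"
    show "alice_won V p" if "game_over V E k (card V) p"
      using that *[OF p] by (auto simp: game_over_def bob_won_def)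
    show "legal_move V E k (card V) p (\<sigma> p)"
      if over: "\<not> game_over V E k (card V) p \<and> even (length p)"
    proof -
      obtain v where "v \<in> uncolored V p"
        using over unfolding game_over_def alice_won_def by blast
      with *[OF p] obtain c where "legal_move V E k (card V) p (v, c)"
        by (auto simp: legal_move_def)
      then show ?thesis
        unfolding \<sigma>_def by (rule someI)
    qed
  qed
  then show ?thesis
    by blast
qed

end

theory Submission
  imports Defs
begin

text \<open>
  A chordal graph has a perfect elimination order, so the earlier neighbours of a vertex \<open>v\<close> form
  a clique, of size at most \<open>k\<close> here. Make the first of them the parent of \<open>v\<close>; this gives a rooted
  forest. If a color \<open>c\<close> is illegal for an uncolored \<open>v\<close>, there is a clique \<open>K\<close> of size \<open>k + 1\<close>
  containing \<open>v\<close> whose other vertices have color \<open>c\<close>. Either \<open>K\<close> contains an earlier neighbour of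
  \<open>v\<close>, which happens for at most \<open>k\<close> colors, or \<open>v\<close> is the first vertex of \<open>K\<close>, and then the last
  vertex of \<open>K\<close> is a colored child of \<open>v\<close>. Hence \<open>k + 3\<close> colors suffice as long as no uncolored
  vertex has more than two colored children. Alice achieves this by the usual strategy for forests:
  after each of her moves every uncolored vertex has at most one child with a colored descendant;
  a move of Bob violates this at one vertex at most, which Alice then colors.
\<close>

section \<open>Chordal graphs have perfect elimination orders\<close>

definition simplicial :: "'a set \<Rightarrow> 'a set set \<Rightarrow> 'a \<Rightarrow> bool" where
  "simplicial V E v \<longleftrightarrow> v \<in> V \<and> clique {u \<in> V. {u, v} \<in> E} E"

lemma chordal_mono: "chordal V E \<Longrightarrow> W \<subseteq> V \<Longrightarrow> chordal W E"
  unfolding chordal_def induced_cycle_def by (meson subset_trans)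

text \<open>Take a walk of least length: a repeated vertex or a forward chord would allow a
  shortcut.\<close>

lemma shortest_path:
  assumes "(s, t) \<in> Q\<^sup>*"
  obtains n f where "f 0 = s" "f n = t" "\<And>i. i < n \<Longrightarrow> (f i, f (Suc i)) \<in> Q"
    "\<And>i j. i < j \<Longrightarrow> j \<le> n \<Longrightarrow> f i \<noteq> f j"
    "\<And>i j. Suc i < j \<Longrightarrow> j \<le> n \<Longrightarrow> (f i, f j) \<notin> Q"
proof -
  define n where "n = (LEAST n. (s, t) \<in> Q ^^ n)"
  have "\<exists>n. (s, t) \<in> Q ^^ n"
    using assms by (simp add: rtrancl_power)
  then have n: "(s, t) \<in> Q ^^ n"
    unfolding n_def by (rule LeastI_ex)
  have least: "n \<le> m" if "(s, t) \<in> Q ^^ m" for m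
    unfolding n_def using that by (rule Least_le)
  from n obtain f where f: "f 0 = s" "f n = t" "\<forall>i<n. (f i, f (Suc i)) \<in> Q"
    by (auto simp: relpow_fun_conv)
  have to: "(s, f i) \<in> Q ^^ i" if "i \<le> n" for i
    using f that by (auto simp: relpow_fun_conv intro!: exI[of _ f])
  have from_: "(f j, t) \<in> Q ^^ (n - j)" if "j \<le> n" for j
    using f that by (auto simp: relpow_fun_conv intro!: exI[of _ "\<lambda>l. f (l + j)"])
  show thesis
  proof (rule that[of f n])
    fix i j assume "i < j" "j \<le> n"
    show "f i \<noteq> f j"
    proof
      assume "f i = f j"
      then have "(s, t) \<in> Q ^^ (i + (n - j))"
        using to[of i] from_[of j] \<open>i < j\<close> \<open>j \<le> n\<close> unfolding relpow_add by auto
      from least[OF this] \<open>i < j\<close> \<open>j \<le> n\<close> show False by simp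
    qed
  next
    fix i j assume "Suc i < j" "j \<le> n"
    show "(f i, f j) \<notin> Q"
    proof
      assume "(f i, f j) \<in> Q"
      then have "(s, f j) \<in> Q ^^ Suc i"
        using to[of i] \<open>Suc i < j\<close> \<open>j \<le> n\<close> by auto
      then have "(s, t) \<in> Q ^^ (Suc i + (n - j))"
        using from_[of j] \<open>j \<le> n\<close> unfolding relpow_add by blast
      from least[OF this] \<open>Suc i < j\<close> \<open>j \<le> n\<close> show False by simp
    qed
  qed (use f in auto)
qed

text \<open>If \<open>s\<close> and \<open>t\<close> were not adjacent, a shortest path from
  \<open>s\<close> to \<open>t\<close> through \<open>C\<close>, closed up by \<open>x\<close>,
  would be an induced cycle of length at least 4.\<close>

lemma chordal_connected_nonneighbours:
  assumes ch: "chordal V E" and x: "x \<in> V" and s: "s \<in> V" "{x, s} \<in> E" "s \<noteq> x"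
    and t: "t \<in> V" "{x, t} \<in> E" "t \<noteq> x" and C: "C \<subseteq> V" "x \<notin> C" "\<And>y. y \<in> C \<Longrightarrow> {x, y} \<notin> E"
    and path: "(s, t) \<in> {(a, b). a \<in> C \<union> {s, t} \<and> b \<in> C \<union> {s, t} \<and> {a, b} \<in> E}\<^sup>*"
    and "s \<noteq> t"
  shows "{s, t} \<in> E"
proof (rule ccontr)
  assume nst: "{s, t} \<notin> E"
  define Q where "Q = {(a, b). a \<in> C \<union> {s, t} \<and> b \<in> C \<union> {s, t} \<and> {a, b} \<in> E}"
  obtain n f where f: "f 0 = s" "f n = t" "\<And>i. i < n \<Longrightarrow> (f i, f (Suc i)) \<in> Q"
    "\<And>i j. i < j \<Longrightarrow> j \<le> n \<Longrightarrow> f i \<noteq> f j"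
    "\<And>i j. Suc i < j \<Longrightarrow> j \<le> n \<Longrightarrow> (f i, f j) \<notin> Q"
    using shortest_path[OF path[folded Q_def]] by metis
  \<comment> \<open>The cycle will have \<open>n + 2\<close> vertices, so this is the bound that
    contradicts chordality.\<close>
  have n: "2 \<le> n"
  proof (rule ccontr)
    assume "\<not> 2 \<le> n"
    then have "n = 0 \<or> n = 1" by auto
    then show False using f(1,2) f(3)[of 0] \<open>s \<noteq> t\<close> nst by (auto simp: Q_def)
  qed
  have mem: "f i \<in> C \<union> {s, t}" if "i \<le> n" for i
  proof (cases "i < n")
    case True
    from f(3)[OF this] show ?thesis by (auto simp: Q_def)
  next
    case False
    with that f(2) show ?thesis by auto
  qed
  have inner: "f i \<in> C" if "0 < i" "i < n" for i
    using mem[of i] that f(4)[of 0 i] f(4)[of i n] f(1,2) by auto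
  have edge: "{f i, f j} \<in> E \<longleftrightarrow> j = Suc i" if "i < j" "j \<le> n" for i j
  proof
    assume "{f i, f j} \<in> E"
    then have "(f i, f j) \<in> Q" using mem[of i] mem[of j] that by (auto simp: Q_def)
    then show "j = Suc i" using f(5)[of i j] that by force
  next
    assume "j = Suc i"
    then show "{f i, f j} \<in> E" using f(3)[of i] that by (auto simp: Q_def)
  qed
  have xf: "{x, f i} \<in> E \<longleftrightarrow> i = 0 \<or> i = n" if "i \<le> n" for i
    using inner[of i] C(3) s t f(1,2) that by (cases "i = 0"; cases "i = n") auto
  define xs where "xs = x # map f [0..<Suc n]"
  have len: "length xs = n + 2" by (simp add: xs_def)
  have nth: "xs ! i = (if i = 0 then x else f (i - 1))" if "i < n + 2" for i
    using that by (cases i) (auto simp: xs_def nth_append less_Suc_eq simp del: upt_Suc)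
  have "induced_cycle V E xs"
    unfolding induced_cycle_def
  proof (intro conjI allI impI)
    show "3 \<le> length xs" using n len by simp
    have "inj_on f {0..n}"
      by (intro linorder_inj_onI) (use f(4) in auto)
    moreover have "f i \<noteq> x" if "i \<le> n" for i
      using mem[OF that] s(3) t(3) C(2) by auto
    ultimately show "distinct xs"
      by (force simp: xs_def distinct_map atLeastLessThanSuc_atLeastAtMost simp del: upt_Suc)
    have "f i \<in> V" if "i \<le> n" for i
      using mem[OF that] s(1) t(1) C(1) by auto
    then show "set xs \<subseteq> V"
      using x by (auto simp: xs_def simp del: upt_Suc)
    fix i j assume ij: "i < j \<and> j < length xs"
    show "({xs ! i, xs ! j} \<in> E) = (j = Suc i \<or> i = 0 \<and> Suc j = length xs)"
    proof (cases "i = 0")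
      case True
      then show ?thesis using ij xf[of "j - 1"] len by (cases j) (auto simp: nth)
    next
      case False
      then show ?thesis using ij edge[of "i - 1" "j - 1"] len by (cases i; cases j) (auto simp: nth)
    qed
  qed
  then show False using ch n len by (auto simp: chordal_def)
qed

text \<open>
  Let \<open>C\<close> be a component of the non-neighbours of \<open>x\<close> and \<open>S\<close> the neighbours of \<open>x\<close> adjacent to \<open>C\<close>.
  By chordality \<open>S\<close> is a clique, and the induction hypothesis for \<open>C \<union> S\<close> gives a vertex of \<open>C\<close>
  that is simplicial in \<open>C \<union> S\<close> and therefore in \<open>V\<close>.
\<close>

lemma chordal_simplicial_nonneighbour:
  assumes "finite V" "chordal V E" "x \<in> V" "z \<in> V" "z \<noteq> x" "{x, z} \<notin> E"
  shows "\<exists>y. simplicial V E y \<and> y \<noteq> x \<and> {x, y} \<notin> E"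
  using assms
proof (induction "card V" arbitrary: V x z rule: less_induct)
  case less
  define W where "W = {y \<in> V. y \<noteq> x \<and> {x, y} \<notin> E}"
  define R where "R = {(a, b). a \<in> W \<and> b \<in> W \<and> {a, b} \<in> E}"
  define C where "C = R\<^sup>* `` {z}"
  define S where "S = {s \<in> V. s \<noteq> x \<and> {x, s} \<in> E \<and> (\<exists>c\<in>C. {s, c} \<in> E)}"
  have zC: "z \<in> C" by (simp add: C_def)
  have CW: "C \<subseteq> W"
  proof
    fix y assume "y \<in> C"
    then have "(z, y) \<in> R\<^sup>*" by (simp add: C_def)
    then show "y \<in> W"
      by (induction) (use less.prems in \<open>auto simp: W_def R_def\<close>)
  qed
  have sym: "sym R"
    by (auto simp: sym_def R_def insert_commute)
  \<comment> \<open>Every vertex on an \<open>R\<close>-walk from \<open>z\<close> lies in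
    \<open>C\<close>, so walks between \<open>a\<close> and \<open>b\<close> via \<open>z\<close>
    stay inside \<open>C\<close>.\<close>
  have conn: "(a, b) \<in> (R \<inter> C \<times> C)\<^sup>*" if "a \<in> C" "b \<in> C" for a b
  proof -
    have *: "(z, y) \<in> (R \<inter> C \<times> C)\<^sup>*" if "(z, y) \<in> R\<^sup>*" for y
      using that
    proof induction
      case (step u v)
      then have "u \<in> C" "v \<in> C" by (auto simp: C_def intro: rtrancl_into_rtrancl)
      with step show ?case by (auto intro: rtrancl_into_rtrancl)
    qed simp
    have "sym ((R \<inter> C \<times> C)\<^sup>*)"
      using sym by (intro sym_rtrancl) (auto simp: sym_def)
    then show ?thesis using *[of a] *[of b] that
      by (auto simp: C_def dest: symD intro: rtrancl_trans)
  qed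
  have cliqueS: "{s, t} \<in> E" if st: "s \<in> S" "t \<in> S" "s \<noteq> t" for s t
  proof -
    let ?Q = "{(a, b). a \<in> C \<union> {s, t} \<and> b \<in> C \<union> {s, t} \<and> {a, b} \<in> E}"
    from st obtain c d where c: "c \<in> C" "{s, c} \<in> E" and d: "d \<in> C" "{t, d} \<in> E"
      by (auto simp: S_def)
    have "R \<inter> C \<times> C \<subseteq> ?Q" by (auto simp: R_def)
    from rtrancl_mono[OF this] have "(c, d) \<in> ?Q\<^sup>*"
      using conn[OF c(1) d(1)] by blast
    moreover have "(s, c) \<in> ?Q" "(d, t) \<in> ?Q"
      using c d by (auto simp: insert_commute)
    ultimately have "(s, t) \<in> ?Q\<^sup>*"
      by (meson converse_rtrancl_into_rtrancl rtrancl_into_rtrancl)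
    then show ?thesis
      using less.prems st CW
      by (intro chordal_connected_nonneighbours[of V E x s t C]) (auto simp: S_def W_def)
  qed
  have nbC: "u \<in> C \<union> S" if "u \<in> V" "y \<in> C" "{u, y} \<in> E" for u y
  proof (cases "u \<in> W")
    case True
    then have "(y, u) \<in> R" using that CW by (auto simp: R_def insert_commute)
    then show ?thesis using that by (auto simp: C_def intro: rtrancl_into_rtrancl)
  next
    case False
    then show ?thesis using that CW by (auto simp: S_def W_def)
  qed
  have lift: ?case if "y \<in> C" "simplicial (C \<union> S) E y" for y
  proof -
    have "{u \<in> V. {u, y} \<in> E} \<subseteq> {u \<in> C \<union> S. {u, y} \<in> E}"
      using nbC that by auto
    moreover have "clique {u \<in> C \<union> S. {u, y} \<in> E} E" "y \<in> V"
      using that CW unfolding simplicial_def W_def by blast+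
    ultimately have "simplicial V E y"
      unfolding simplicial_def clique_def by blast
    then show ?thesis using that CW by (auto simp: W_def)
  qed
  have sub: "C \<union> S \<subseteq> V" using CW by (auto simp: S_def W_def)
  \<comment> \<open>The vertex \<open>x\<close> lies in neither \<open>C\<close> nor
    \<open>S\<close>.\<close>
  have "C \<union> S \<subset> V" using sub CW less.prems by (auto simp: S_def W_def)
  then have less_card: "card (C \<union> S) < card V"
    using less.prems by (simp add: psubset_card_mono)
  have IH: "\<exists>y. simplicial (C \<union> S) E y \<and> y \<noteq> a \<and> {a, y} \<notin> E"
    if "a \<in> C \<union> S" "b \<in> C \<union> S" "b \<noteq> a" "{a, b} \<notin> E" for a b
    using less.hyps[OF less_card _ _ that] sub less.prems
    by (meson chordal_mono finite_subset)
  \<comment> \<open>The non-neighbour \<open>a\<close> given to the induction hypothesis must force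
    \<open>y\<close> out of \<open>S\<close>. If \<open>a\<close> is in \<open>S\<close>, this holds
    because \<open>S\<close> is a clique; if \<open>a\<close> is in \<open>C\<close>, because here
    \<open>S\<close> is joined to everything. With no non-adjacent pair left, \<open>z\<close>
    itself is simplicial.\<close>
  consider (S) a b where "a \<in> S" "b \<in> C \<union> S" "b \<noteq> a" "{a, b} \<notin> E"
    | (C) a b where "\<forall>s\<in>S. \<forall>u\<in>C \<union> S. u \<noteq> s \<longrightarrow> {s, u} \<in> E" "a \<in> C" "b \<in> C" "b \<noteq> a" "{a, b} \<notin> E"
    | (complete) "\<forall>s\<in>C \<union> S. \<forall>u\<in>C \<union> S. u \<noteq> s \<longrightarrow> {s, u} \<in> E"
    by (metis Un_iff insert_commute)
  then show ?case
  proof cases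
    case S
    then obtain y where y: "simplicial (C \<union> S) E y" "y \<noteq> a" "{a, y} \<notin> E"
      using IH[of a b] by auto
    then have "y \<in> C" using cliqueS[of a y] S by (auto simp: simplicial_def)
    then show ?thesis using lift y by blast
  next
    case C
    then obtain y where y: "simplicial (C \<union> S) E y" "y \<noteq> a" "{a, y} \<notin> E"
      using IH[of a b] by auto
    moreover from y C(1,2) have "y \<notin> S"
      by (metis UnI1 insert_commute)
    ultimately have "y \<in> C" by (simp add: simplicial_def)
    then show ?thesis using lift y by blast
  next
    case complete
    then have "simplicial (C \<union> S) E z"
      using zC by (auto simp: simplicial_def clique_def)
    then show ?thesis using lift zC by blast
  qed
qed

lemma chordal_simplicial_exists:
  assumes "finite V" "chordal V E" "V \<noteq> {}"
  shows "\<exists>y. simplicial V E y"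
proof (cases "clique V E")
  case True
  then show ?thesis using assms(3) by (auto simp: simplicial_def clique_def)
next
  case False
  then show ?thesis
    using chordal_simplicial_nonneighbour[OF assms(1,2)] unfolding clique_def by metis
qed

definition earlier_nbrs :: "'a set \<Rightarrow> 'a set set \<Rightarrow> ('a \<Rightarrow> nat) \<Rightarrow> 'a \<Rightarrow> 'a set" where
  "earlier_nbrs V E r v = {u \<in> V. {u, v} \<in> E \<and> r u < r v}"

text \<open>A perfect elimination order read backwards: vertices are eliminated by decreasing
  position \<open>r\<close>.\<close>

definition perfect_order :: "'a set \<Rightarrow> 'a set set \<Rightarrow> ('a \<Rightarrow> nat) \<Rightarrow> bool" where
  "perfect_order V E r \<longleftrightarrow> inj_on r V \<and> (\<forall>v\<in>V. clique (earlier_nbrs V E r v) E)"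

text \<open>Put a simplicial vertex last and order the rest by induction.\<close>

lemma chordal_perfect_order:
  assumes "finite V" "chordal V E"
  shows "\<exists>r. perfect_order V E r"
proof -
  \<comment> \<open>The bound on \<open>r\<close> makes \<open>n\<close> a free position after all
    others for the removed vertex.\<close>
  have "\<exists>r. perfect_order V E r \<and> (\<forall>v\<in>V. r v < card V)"
    using assms
  proof (induction "card V" arbitrary: V)
    case 0
    then show ?case by (auto simp: perfect_order_def)
  next
    case (Suc n)
    then have "V \<noteq> {}" by auto
    then obtain y where y: "simplicial V E y"
      using chordal_simplicial_exists Suc.prems by blast
    then have yV: "y \<in> V" by (simp add: simplicial_def)
    define W where "W = V - {y}"
    have W: "n = card W" "finite W" "chordal W E"
      using Suc yV by (auto simp: W_def intro: chordal_mono)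
    then obtain r where r: "perfect_order W E r" "\<forall>v\<in>W. r v < n"
      using Suc.hyps(1)[of W] by auto
    define r' where "r' = r(y := n)"
    have "inj_on r' V"
      using r by (auto simp: inj_on_def perfect_order_def r'_def W_def)
    moreover have "clique (earlier_nbrs V E r' v) E" if "v \<in> V" for v
    proof (cases "v = y")
      case True
      then show ?thesis using y
        by (auto simp: simplicial_def earlier_nbrs_def clique_def)
    next
      case False
      then have vW: "v \<in> W" using that by (simp add: W_def)
      then have "earlier_nbrs V E r' v = earlier_nbrs W E r v"
        using bspec[OF r(2) vW] by (auto simp: earlier_nbrs_def r'_def W_def)
      then show ?thesis using r(1) vW by (simp add: perfect_order_def)
    qed
    moreover have "r' v < card V" if "v \<in> V" for v
      using r(2) that Suc.hyps(2)[symmetric] by (force simp: r'_def W_def)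
    ultimately show ?case unfolding perfect_order_def by blast
  qed
  then show ?thesis by blast
qed

section \<open>Alice's strategy on a rooted forest\<close>

text \<open>A rooted forest is a relation \<open>P\<close> from children to parents.\<close>

definition active_children :: "('a \<times> 'a) set \<Rightarrow> 'a set \<Rightarrow> 'a \<Rightarrow> 'a set" where
  "active_children P S v = {w \<in> P\<^sup>* `` S. (w, v) \<in> P}"

text \<open>The image of \<open>S\<close> under \<open>P\<^sup>*\<close> is \<open>S\<close> with
  all its ancestors, called active below. The ancestors of an active \<open>b\<close> are active
  already.\<close>

lemma rtrancl_Image_insert_active:
  "b \<in> P\<^sup>* `` S \<Longrightarrow> P\<^sup>* `` insert b S = P\<^sup>* `` S"
  by (auto intro: rtrancl_trans)

lemma rtrancl_Image_insert_root:
  assumes "b \<notin> Domain P"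
  shows "P\<^sup>* `` insert b S = insert b (P\<^sup>* `` S)"
  using assms by (auto elim: converse_rtranclE)

text \<open>A path upwards from \<open>b\<close> either stops at \<open>b\<close> or passes through
  its only parent \<open>p\<close>.\<close>

lemma rtrancl_Image_insert_child:
  assumes "single_valued P" "(b, p) \<in> P"
  shows "P\<^sup>* `` insert b S = insert b (P\<^sup>* `` insert p S)"
proof -
  have "y = b \<or> (p, y) \<in> P\<^sup>*" if "(b, y) \<in> P\<^sup>*" for y
    using that assms by (metis converse_rtranclE single_valuedD)
  then show ?thesis using assms(2) by (auto intro: converse_rtrancl_into_rtrancl)
qed

lemma active_children_insert_root:
  assumes "b \<notin> Domain P"
  shows "active_children P (insert b S) v = active_children P S v"
  using assms unfolding active_children_def rtrancl_Image_insert_root[OF assms] by auto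

lemma active_children_insert_child:
  assumes "single_valued P" "(b, p) \<in> P"
  shows "active_children P (insert b S) v =
    (if v = p then {b} else {}) \<union> active_children P (insert p S) v"
  using assms unfolding active_children_def rtrancl_Image_insert_child[OF assms]
  by (auto dest: single_valuedD)

lemma active_children_insert_active:
  "b \<in> P\<^sup>* `` S \<Longrightarrow> active_children P (insert b S) v = active_children P S v"
  unfolding active_children_def by (simp only: rtrancl_Image_insert_active)

text \<open>Adding \<open>b\<close> activates the path from \<open>b\<close> up to the first vertex
  that is already active, if any. Only that vertex can reach two active children: the newly active
  ones had none before. The induction climbs from \<open>b\<close> to its parent.\<close>

lemma active_children_insert:
  assumes "single_valued P" "wf (P\<inverse>)" and le: "\<forall>v\<in>U. card (active_children P S v) \<le> 1"
  shows "\<exists>u. \<forall>v\<in>U. card (active_children P (insert b S) v) \<le> (if v = u then 2 else 1)"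
  using assms(2)
proof (induction b rule: wf_induct_rule)
  case (less b)
  show ?case
  proof (cases "b \<in> P\<^sup>* `` S \<or> b \<notin> Domain P")
    case True
    then have "active_children P (insert b S) v = active_children P S v" for v
      using active_children_insert_active active_children_insert_root by metis
    then show ?thesis using le by (intro exI[of _ b]) auto
  next
    case False
    then obtain p where p: "(b, p) \<in> P" by auto
    note ins = active_children_insert_child[OF assms(1) p]
    show ?thesis
    proof (cases "p \<in> P\<^sup>* `` S")
      case True
      have "card ({b} \<union> active_children P S v) \<le> 2" if "v \<in> U" for v
        using le that card_Un_le[of "{b}" "active_children P S v"] by force
      then show ?thesis
        using le by (intro exI[of _ p]) (auto simp: ins active_children_insert_active[OF True])
    next
      case pS: False
      obtain u where u: "\<forall>v\<in>U. card (active_children P (insert p S) v) \<le> (if v = u then 2 else 1)"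
        using less[of p] p by auto
      have "acyclic P"
        using assms(2) wf_acyclic acyclic_converse by blast
      \<comment> \<open>A child of \<open>p\<close> in \<open>P\<^sup>*\<close>-image of
        \<open>S\<close> would make \<open>p\<close> active, and by acyclicity no child of
        \<open>p\<close> is an ancestor of \<open>p\<close>. So \<open>b\<close> becomes the only
        active child of \<open>p\<close>.\<close>
      have "active_children P (insert p S) p = {}"
      proof -
        have "(p, w) \<notin> P\<^sup>*" if "(w, p) \<in> P" for w
          using \<open>acyclic P\<close> that unfolding acyclic_def by (meson rtrancl_into_trancl1)
        moreover have "w \<notin> P\<^sup>* `` S" if "(w, p) \<in> P" for w
          using pS that by (auto intro: rtrancl_into_rtrancl)
        ultimately show ?thesis unfolding active_children_def by blast
      qed
      then have "card (active_children P (insert b S) v) \<le> (if v = u then 2 else 1)" if "v \<in> U" for v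
        using u that by (auto simp: ins)
      then show ?thesis by blast
    qed
  qed
qed

text \<open>If \<open>u\<close> has two active children, it is active itself, so adding it to
  \<open>S\<close> changes no count and lifts the condition at \<open>u\<close>. Otherwise an
  unmarked vertex whose parent, if any, is in \<open>S\<close> will do: only that parent can gain an
  active child, and its count is not restricted.\<close>

lemma active_children_restore:
  assumes "single_valued P" "wf (P\<inverse>)" "P \<subseteq> V \<times> V" "S \<subset> V"
    and le: "\<forall>v\<in>V - S. card (active_children P S v) \<le> (if v = u then 2 else 1)"
  shows "\<exists>x\<in>V - S. \<forall>v\<in>V - insert x S. card (active_children P (insert x S) v) \<le> 1"
proof (cases "u \<in> V - S \<and> card (active_children P S u) > 1")
  case True
  then have "active_children P S u \<noteq> {}" by auto
  then have "u \<in> P\<^sup>* `` S"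
    unfolding active_children_def by (auto intro: rtrancl_into_rtrancl)
  moreover have "card (active_children P S v) \<le> 1" if "v \<in> V - insert u S" for v
    using bspec[OF le, of v] that by auto
  ultimately have "\<forall>v\<in>V - insert u S. card (active_children P (insert u S) v) \<le> 1"
    by (simp only: active_children_insert_active) blast
  then show ?thesis using True by blast
next
  case False
  then have le1: "\<forall>v\<in>V - S. card (active_children P S v) \<le> 1"
    using le by (metis not_le_imp_less)
  obtain y where "y \<in> V - S" using assms(4) by auto
  then obtain x where x: "x \<in> V - S" and "\<And>p. (p, x) \<in> P\<inverse> \<Longrightarrow> p \<notin> V - S"
    using wfE_min[OF assms(2), where Q = "V - S"] by metis
  then have xp: "p \<notin> V - S" if "(x, p) \<in> P" for p
    using that by blast
  have "card (active_children P (insert x S) v) \<le> 1" if v: "v \<in> V - insert x S" for v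
  proof (cases "x \<in> Domain P")
    case True
    then obtain p where p: "(x, p) \<in> P" by auto
    then have "p \<in> S" using xp[OF p] assms(3) by auto
    then have "active_children P (insert x S) v = active_children P S v"
      using v by (auto simp: active_children_insert_child[OF assms(1) p] insert_absorb)
    then show ?thesis using le1 v by auto
  next
    case False
    then show ?thesis using le1 v by (auto simp: active_children_insert_root)
  qed
  then show ?thesis using x by blast
qed

section \<open>The clique-relaxed game\<close>

text \<open>Choosing the earliest of the earlier neighbours makes the first vertex of a maximum
  clique the parent of the last.\<close>

definition first_nbr :: "'a set \<Rightarrow> 'a set set \<Rightarrow> ('a \<Rightarrow> nat) \<Rightarrow> ('a \<times> 'a) set" where
  "first_nbr V E r = {(w, v). w \<in> V \<and> v \<in> earlier_nbrs V E r w \<and>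
     (\<forall>u\<in>earlier_nbrs V E r w. r v \<le> r u)}"

lemma first_nbr_forest:
  assumes "inj_on r V"
  shows "single_valued (first_nbr V E r)" "wf ((first_nbr V E r)\<inverse>)" "first_nbr V E r \<subseteq> V \<times> V"
proof -
  show "first_nbr V E r \<subseteq> V \<times> V"
    by (auto simp: first_nbr_def earlier_nbrs_def)
  show "single_valued (first_nbr V E r)"
  proof (rule single_valuedI)
    fix w u v assume "(w, u) \<in> first_nbr V E r" "(w, v) \<in> first_nbr V E r"
    then have "r u = r v" "u \<in> V" "v \<in> V"
      by (auto simp: first_nbr_def earlier_nbrs_def intro: antisym)
    then show "u = v" using assms by (auto dest: inj_onD)
  qed
  have "(first_nbr V E r)\<inverse> \<subseteq> measure r"
    by (auto simp: first_nbr_def earlier_nbrs_def)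
  then show "wf ((first_nbr V E r)\<inverse>)"
    using wf_subset wf_measure by blast
qed

lemma card_clique_le_clique_number:
  assumes "finite V" "C \<subseteq> V" "clique C E"
  shows "card C \<le> clique_number V E"
proof -
  have "{card C | C. C \<subseteq> V \<and> clique C E} \<subseteq> card ` Pow V" by auto
  then have "finite {card C | C. C \<subseteq> V \<and> clique C E}"
    using assms(1) by (meson finite_Pow_iff finite_imageI finite_subset)
  then show ?thesis
    unfolding clique_number_def using assms by (intro Max_ge) auto
qed

text \<open>Together with \<open>v\<close>, the earlier neighbours form a clique.\<close>

lemma card_earlier_nbrs_less:
  assumes "finite V" "perfect_order V E r" "v \<in> V"
  shows "card (earlier_nbrs V E r v) < clique_number V E"
proof -
  let ?N = "earlier_nbrs V E r v"
  have N: "?N \<subseteq> V" "v \<notin> ?N" by (auto simp: earlier_nbrs_def)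
  have "clique (insert v ?N) E"
    using assms(2,3) by (auto simp: perfect_order_def clique_def earlier_nbrs_def insert_commute)
  then have "card (insert v ?N) \<le> clique_number V E"
    using assms N by (intro card_clique_le_clique_number) auto
  then show ?thesis
    using N assms(1) finite_subset[of ?N V] by simp
qed

text \<open>Let \<open>w\<close> be the last vertex of \<open>K\<close>. It has fewer than
  \<open>card K\<close> earlier neighbours, and all of \<open>K - {w}\<close> is among them, so
  these sets agree and their first element is \<open>v\<close>.\<close>

lemma clique_first_nbr:
  assumes fin: "finite V" and ord: "perfect_order V E r" and num: "clique_number V E = card K"
    and K: "clique K E" "K \<subseteq> V" "card K > 1" "v \<in> K" "\<forall>u\<in>K. r v \<le> r u"
  shows "\<exists>w\<in>K - {v}. (w, v) \<in> first_nbr V E r"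
proof -
  have finK: "finite K" "K \<noteq> {}" using K by (auto intro: card_ge_0_finite)
  then obtain w where w: "w \<in> K" "\<forall>u\<in>K. r u \<le> r w"
    using Max_in[of "r ` K"] Max_ge[of "r ` K"] by fastforce
  have inj: "inj_on r K" using ord K(2) by (auto simp: perfect_order_def intro: inj_on_subset)
  let ?N = "earlier_nbrs V E r w"
  have sub: "K - {w} \<subseteq> ?N"
  proof
    fix u assume u: "u \<in> K - {w}"
    then have "r u \<noteq> r w" using inj w by (auto dest: inj_onD)
    then have "r u < r w" using u w by (simp add: order_less_le)
    then show "u \<in> ?N" using u w K by (auto simp: earlier_nbrs_def clique_def)
  qed
  have "finite ?N" using fin by (auto simp: earlier_nbrs_def)
  moreover have "card ?N \<le> card (K - {w})"
    using card_earlier_nbrs_less[OF fin ord, of w] num w K finK by auto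
  ultimately have N: "?N = K - {w}"
    using sub card_seteq by blast
  have "w \<noteq> v"
  proof
    assume "w = v"
    then have "\<forall>u\<in>K. u = v"
      using w K inj by (metis inj_onD order_antisym)
    then have "K \<subseteq> {v}" by auto
    then show False using K(3) card_mono[of "{v}" K] by simp
  qed
  then show ?thesis
    using w K N unfolding first_nbr_def by blast
qed

lemma legal_color_if_few_colored_children:
  assumes fin: "finite V" and k: "k \<ge> 1" and ord: "perfect_order V E r"
    and num: "clique_number V E = k + 1"
    and dom: "dom (map_of p) \<subseteq> V" and nomono: "\<not> has_mono_clique E (k + 1) (map_of p)"
    and v: "v \<in> uncolored V p"
    and few: "card (active_children (first_nbr V E r) (dom (map_of p)) v) \<le> 2"
  shows "\<exists>c. legal_color E k (k + 3) p v c"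
proof (rule ccontr)
  assume none: "\<nexists>c. legal_color E k (k + 3) p v c"
  define f where "f = map_of p"
  define X where "X = earlier_nbrs V E r v"
  \<comment> \<open>This may include uncolored children with colored descendants; counting them only
    strengthens the hypothesis.\<close>
  define Y where "Y = active_children (first_nbr V E r) (dom f) v"
  have vV: "v \<in> V" "f v = None" using v by (auto simp: uncolored_def f_def)
  have rep: "\<exists>w\<in>X \<union> Y. f w = Some c" if c: "c < k + 3" for c
  proof -
    have "has_mono_clique E (k + 1) (f(v \<mapsto> c))"
      using none c by (auto simp: legal_color_def f_def)
    then obtain K d where K: "clique K E" "card K = k + 1" "\<forall>u\<in>K. (f(v \<mapsto> c)) u = Some d"
      unfolding has_mono_clique_def by blast
    have vK: "v \<in> K"
    proof (rule ccontr)
      assume "v \<notin> K"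
      with K(3) have "\<forall>u\<in>K. f u = Some d" by (metis fun_upd_other)
      with K nomono show False by (auto simp: has_mono_clique_def f_def)
    qed
    with K(3) have "d = c" by auto
    with K(3) have col: "f u = Some c" if "u \<in> K - {v}" for u
      using that by auto
    \<comment> \<open>A monochromatic clique is not confined to \<open>V\<close> by definition, but
      colored vertices lie in \<open>V\<close>.\<close>
    have KV: "K \<subseteq> V"
      using col dom vV by (fastforce simp: f_def)
    show ?thesis
    proof (cases "\<exists>u\<in>K. r u < r v")
      case True
      then obtain u where "u \<in> K" "r u < r v" by auto
      then have "u \<in> X" "u \<in> K - {v}" using K(1) KV vK by (auto simp: X_def earlier_nbrs_def clique_def)
      then show ?thesis using col by blast
    next
      case False
      then obtain w where w: "w \<in> K - {v}" "(w, v) \<in> first_nbr V E r"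
        using clique_first_nbr[OF fin ord, of K v] num K KV vK k by (auto simp: not_less)
      then have "w \<in> Y" using col[of w] by (auto simp: Y_def active_children_def)
      then show ?thesis using col w by blast
    qed
  qed
  have "finite X" "Y \<subseteq> V"
    using fin by (auto simp: X_def Y_def earlier_nbrs_def active_children_def first_nbr_def)
  then have finXY: "finite (X \<union> Y)" using fin finite_subset by auto
  \<comment> \<open>Every color being illegal, all \<open>k + 3\<close> occur on
    \<open>X \<union> Y\<close>, which has at most \<open>k + 2\<close> vertices.\<close>
  have "{..<k + 3} \<subseteq> (the \<circ> f) ` (X \<union> Y)"
    using rep by force
  then have "k + 3 \<le> card ((the \<circ> f) ` (X \<union> Y))"
    using finXY card_mono[of "(the \<circ> f) ` (X \<union> Y)" "{..<k + 3}"] by simp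
  also have "\<dots> \<le> card (X \<union> Y)" by (rule card_image_le[OF finXY])
  also have "\<dots> \<le> card X + card Y" by (rule card_Un_le)
  also have "\<dots> \<le> k + 2"
    using card_earlier_nbrs_less[OF fin ord vV(1)] num few by (auto simp: X_def Y_def f_def)
  finally show False by simp
qed

lemma dom_map_of_Cons: "dom (map_of (m # p)) = insert (fst m) (dom (map_of p))"
  by (cases m) auto

lemma winning_strategy_chordal:
  assumes fin: "finite V" and k: "k \<ge> 1" and ch: "chordal V E"
    and num: "clique_number V E = k + 1"
  shows "\<exists>\<sigma>. winning_strategy V E k (k + 3) \<sigma>"
proof -
  obtain r where ord: "perfect_order V E r"
    using chordal_perfect_order[OF fin ch] by blast
  define P where "P = first_nbr V E r"
  have P: "single_valued P" "wf (P\<inverse>)" "P \<subseteq> V \<times> V"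
    using first_nbr_forest[of r V E] ord by (auto simp: P_def perfect_order_def)
  \<comment> \<open>\<open>tidy\<close> will hold after each move of Alice,
    \<open>almost_tidy\<close> at every position; the latter suffices for legal colors to
    exist.\<close>
  define tidy where "tidy S \<longleftrightarrow> (\<forall>v\<in>V - S. card (active_children P S v) \<le> 1)" for S
  define almost_tidy where "almost_tidy S \<longleftrightarrow>
    (\<exists>u. \<forall>v\<in>V - S. card (active_children P S v) \<le> (if v = u then 2 else 1))" for S
  define \<sigma> where "\<sigma> p = (SOME m. legal_move V E k (k + 3) p m \<and> tidy (dom (map_of (m # p))))" for p
  have legal: "\<exists>c. legal_color E k (k + 3) p v c"
    if p: "p \<in> plays_of V E k (k + 3) \<sigma>" and v: "v \<in> uncolored V p"
      and almost: "almost_tidy (dom (map_of p))" for p v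
  proof -
    obtain u where "card (active_children P (dom (map_of p)) v) \<le> (if v = u then 2 else 1)"
      using v almost unfolding almost_tidy_def uncolored_def by blast
    then have "card (active_children P (dom (map_of p)) v) \<le> 2"
      by (simp split: if_splits)
    then show ?thesis
      using legal_color_if_few_colored_children[OF fin k ord num] v
        plays_of_no_mono_clique[OF p] by (simp add: P_def)
  qed
  have alice_move: "legal_move V E k (k + 3) p (\<sigma> p) \<and> tidy (dom (map_of (\<sigma> p # p)))"
    if p: "p \<in> plays_of V E k (k + 3) \<sigma>" "\<not> game_over V E k (k + 3) p"
      and almost: "almost_tidy (dom (map_of p))" for p
  proof -
    have "dom (map_of p) \<subset> V"
      using plays_of_no_mono_clique[OF p(1)] p(2)
      by (auto simp: game_over_def alice_won_def uncolored_def)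
    then obtain x where x: "x \<in> V - dom (map_of p)" "tidy (insert x (dom (map_of p)))"
      using active_children_restore[OF P] almost unfolding almost_tidy_def tidy_def by metis
    then obtain c where "legal_color E k (k + 3) p x c"
      using legal[OF p(1) _ almost, of x] unfolding uncolored_def by blast
    then have "legal_move V E k (k + 3) p (x, c) \<and> tidy (dom (map_of ((x, c) # p)))"
      using x by (simp add: legal_move_def uncolored_def)
    then show ?thesis
      unfolding \<sigma>_def by (rule someI)
  qed
  \<comment> \<open>No exceptional vertex is needed here, so any \<open>u\<close> serves.\<close>
  have tidy_almost: "almost_tidy S" if "tidy S" for S
    using that unfolding tidy_def almost_tidy_def by (intro exI[of _ undefined]) force
  have inv: "almost_tidy (dom (map_of p)) \<and> (odd (length p) \<longrightarrow> tidy (dom (map_of p)))"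
    if "p \<in> plays_of V E k (k + 3) \<sigma>" for p
    using that
  proof (induction rule: plays_of.induct)
    case start
    have "tidy {}" by (simp add: tidy_def active_children_def)
    then show ?case using tidy_almost by simp
  next
    case (alice p)
    then show ?case using alice_move[of p] tidy_almost by blast
  next
    case (bob p m)
    then have "\<forall>v\<in>V - dom (map_of p). card (active_children P (dom (map_of p)) v) \<le> 1"
      by (simp add: tidy_def)
    from active_children_insert[OF P(1,2) this, of "fst m"]
    have "almost_tidy (dom (map_of (m # p)))"
      unfolding almost_tidy_def dom_map_of_Cons by blast
    then show ?case using bob.hyps by (simp del: map_of.simps)
  qed
  have "winning_strategy V E k (k + 3) \<sigma>"
    unfolding winning_strategy_def
  proof (intro ballI conjI impI)
    fix p assume p: "p \<in> plays_of V E k (k + 3) \<sigma>"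
    show "legal_move V E k (k + 3) p (\<sigma> p)" if "\<not> game_over V E k (k + 3) p \<and> even (length p)"
      using alice_move[OF p] inv[OF p] that by blast
    \<comment> \<open>Bob cannot have won, since every uncolored vertex has a legal color, also
      right after his own moves.\<close>
    show "alice_won V p" if "game_over V E k (k + 3) p"
      using that legal[OF p] inv[OF p] by (auto simp: game_over_def bob_won_def)
  qed
  then show ?thesis by blast
qed

theorem theorem3p4:
  fixes V :: "'a set" and E :: "'a set set" and k :: nat
  assumes "k \<ge> 1"
    and "finite_graph V E"
    and "chordal V E"
    and "clique_number V E = k + 1"
  shows "game_chromatic_number k V E \<le> k + 3"
  unfolding game_chromatic_number_def
  using assms winning_strategy_chordal by (intro Least_le) (auto simp: finite_graph_def)

end
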